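(* Let $f$ be a simple and convex function on $\mathbb{R}^n$. Then $\mathbf{T}(j^1f)$ is the $1$-graph of the Legendre--Fenchel transform of $f$: $$\mathbf{T}(j^1f)=j^1f^*.$$ Thus $f^*$ is also simple and convex.
   Context: All functions are smooth and finite-valued unless indicated. A function $f$ on $\mathbb{R}^n$ is simple if its gradient map $\nabla f$ is a diffeomorphism of $\mathbb{R}^n$. The Legendre--Fenchel transform is $f^*(q)=\sup_{v\in\mathbb{R}^n}\{qv-f(v)\}$, where $qv$ is the Euclidean scalar product. The $1$-graph of $f$ is $j^1f=\{(f(q),q,\nabla f(q))\mid q\in\mathbb{R}^n\}\subset J^1(\mathbb{R}^n,\mathbb{R})=\mathbb{R}\times\mathbb{R}^n\times\mathbb{R}^n$ (coordinates $(u,q,p)$), and $\mathbf{T}:J^1(\mathbb{R}^n,\mathbb{R})\to J^1(\mathbb{R}^n,\mathbb{R})$ is $\mathbf{T}(u,q,p)=(qp-u,p,q)$. *)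

theory Defs
  imports "HOL-Analysis.Analysis"
begin

text \<open>
  \<open>C\<^sup>k\<close> on the whole space. In finite dimension, \<open>x \<mapsto> Df(x)\<close> is \<open>C\<^sup>k\<close> iff all the
  maps \<open>x \<mapsto> Df(x) v\<close> are, which keeps the recursion inside one function type.
\<close>

primrec Ck :: "nat \<Rightarrow> ('a::euclidean_space \<Rightarrow> 'b::euclidean_space) \<Rightarrow> bool" where
  "Ck 0 f \<longleftrightarrow> continuous_on UNIV f"
| "Ck (Suc k) f \<longleftrightarrow> (\<forall>x. f differentiable (at x)) \<and>
     (\<forall>v. Ck k (\<lambda>x. frechet_derivative f (at x) v))"

definition smooth :: "('a::euclidean_space \<Rightarrow> 'b::euclidean_space) \<Rightarrow> bool" where
  "smooth f \<longleftrightarrow> (\<forall>k. Ck k f)"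

definition diffeomorphism :: "('a::euclidean_space \<Rightarrow> 'b::euclidean_space) \<Rightarrow> bool" where
  "diffeomorphism g \<longleftrightarrow> bij g \<and> smooth g \<and> smooth (inv g)"

text \<open>Meaningful only where \<open>f\<close> is differentiable.\<close>

definition gradient :: "('a::euclidean_space \<Rightarrow> real) \<Rightarrow> 'a \<Rightarrow> 'a" where
  "gradient f x = (THE D. GDERIV f x :> D)"

definition simple :: "('a::euclidean_space \<Rightarrow> real) \<Rightarrow> bool" where
  "simple f \<longleftrightarrow> smooth f \<and> diffeomorphism (gradient f)"

text \<open>
  Extended-real valued, because the supremum of a set of reals that is not bounded above
  would be an unspecified real number.
\<close>

definition legendre_fenchel :: "('a::euclidean_space \<Rightarrow> real) \<Rightarrow> 'a \<Rightarrow> ereal" where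
  "legendre_fenchel f q = (SUP v. ereal (q \<bullet> v - f v))"

type_synonym 'a jet_space = "real \<times> 'a \<times> 'a"

definition one_graph :: "('a::euclidean_space \<Rightarrow> real) \<Rightarrow> 'a jet_space set" where
  "one_graph f = {(f q, q, gradient f q) | q. True}"

definition T_map :: "'a::euclidean_space jet_space \<Rightarrow> 'a jet_space" where
  "T_map = (\<lambda>(u, q, p). (q \<bullet> p - u, p, q))"

end

theory Submission
  imports Defs
begin

text \<open>
  A differentiable convex \<open>f\<close> lies above its tangent planes, so at a slope \<open>q = \<nabla>f(x)\<close> the
  supremum defining the Legendre--Fenchel transform is attained at \<open>x\<close>. As \<open>\<nabla>f\<close> is
  bijective, every \<open>q\<close> is such a slope, for the unique point \<open>x = K(q)\<close> with \<open>K = (\<nabla>f)\<^sup>-\<^sup>1\<close>.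
  Hence \<open>f\<^sup>*(q) = q \<bullet> K(q) - f(K(q))\<close> is finite (\<open>legendre_fenchel_at_gradient\<close>).

  When this formula is differentiated, the two terms containing the derivative of \<open>K\<close> cancel,
  because \<open>\<nabla>f(K(q)) = q\<close>. What remains is \<open>\<nabla>f\<^sup>* = K\<close> (\<open>GDERIV_legendre_transform\<close>). So the jet of
  \<open>f\<^sup>*\<close> over \<open>q = \<nabla>f(x)\<close> is \<open>(q \<bullet> x - f(x), q, x)\<close>, which is the image under \<open>\<^bold>T\<close> of the jet
  of \<open>f\<close> over \<open>x\<close>. Smoothness of \<open>f\<^sup>*\<close> follows from smoothness of its gradient \<open>K\<close>, which
  is a diffeomorphism since \<open>\<nabla>f\<close> is; convexity holds because \<open>f\<^sup>*\<close> is a supremum of affine functions.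
\<close>

lemma smooth_imp_differentiable:
  assumes "smooth f"
  shows "f differentiable (at x)"
proof -
  have "Ck (Suc 0) f"
    using assms unfolding smooth_def by blast
  then show ?thesis by simp
qed

lemma GDERIV_unique:
  assumes "GDERIV f x :> D" "GDERIV f x :> E"
  shows "D = E"
proof -
  have "(\<lambda>h. h \<bullet> D) = (\<lambda>h. h \<bullet> E)"
    using assms unfolding gderiv_def by (rule has_derivative_unique)
  then have "h \<bullet> D = h \<bullet> E" for h
    by (rule fun_cong)
  then show ?thesis
    using vector_eq_ldot[of D E] by blast
qed

lemma gradient_eq:
  assumes "GDERIV f x :> D"
  shows "gradient f x = D"
  unfolding gradient_def using assms by (rule the_equality) (rule GDERIV_unique[OF _ assms])

lemma GDERIV_gradient:
  fixes f :: "'a::euclidean_space \<Rightarrow> real"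
  assumes "f differentiable (at x)"
  shows "GDERIV f x :> gradient f x"
proof -
  obtain L where L: "(f has_derivative L) (at x)"
    using assms unfolding differentiable_def by blast
  then have "linear L"
    by (rule has_derivative_linear)
  \<comment> \<open>The adjoint of \<open>L\<close> supplies its Riesz representative.\<close>
  then have "L h = h \<bullet> adjoint L 1" for h
    using adjoint_works[of L h 1] by simp
  then have "L = (\<lambda>h. h \<bullet> adjoint L 1)"
    by (rule ext)
  with L have "(f has_derivative (\<lambda>h. h \<bullet> adjoint L 1)) (at x)"
    by (rule subst[rotated])
  then have "GDERIV f x :> adjoint L 1"
    unfolding gderiv_def .
  then show ?thesis
    using gradient_eq[of f x "adjoint L 1"] by simp
qed

lemma Ck_bounded_linear:
  assumes "bounded_linear L" "Ck k f"
  shows "Ck k (\<lambda>x. L (f x))"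
  using assms(2)
proof (induction k arbitrary: f)
  case 0
  then show ?case
    using bounded_linear.continuous_on[OF assms(1)] by simp
next
  case (Suc k)
  have deriv: "((\<lambda>x. L (f x)) has_derivative (\<lambda>v. L (frechet_derivative f (at x) v))) (at x)" for x
    using Suc.prems by (intro bounded_linear.has_derivative[OF assms(1)])
      (simp add: frechet_derivative_works[symmetric])
  then have "frechet_derivative (\<lambda>x. L (f x)) (at x) = (\<lambda>v. L (frechet_derivative f (at x) v))" for x
    by (rule frechet_derivative_at[symmetric])
  moreover have "(\<lambda>x. L (f x)) differentiable (at x)" for x
    using deriv unfolding differentiable_def by blast
  ultimately show ?case
    using Suc by simp
qed

text \<open>
  The directional derivatives \<open>v \<bullet> K\<close> are linear images of \<open>K\<close>, so they inherit its regularity;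
  this spares differentiating \<open>q \<bullet> K(q) - f(K(q))\<close> to higher order.
\<close>

lemma smooth_if_gradient_smooth:
  fixes g :: "'a::euclidean_space \<Rightarrow> real"
  assumes D: "\<And>x. GDERIV g x :> K x" and "smooth K"
  shows "smooth g"
  unfolding smooth_def
proof
  fix k
  have diff: "g differentiable (at x)" for x
    using D[of x] unfolding gderiv_def differentiable_def by blast
  show "Ck k g"
  proof (cases k)
    case 0
    have "continuous_on UNIV g"
      using diff differentiable_imp_continuous_within[of g]
      by (intro continuous_at_imp_continuous_on ballI) blast
    with 0 show ?thesis by simp
  next
    case (Suc j)
    have "frechet_derivative g (at x) = (\<lambda>v. v \<bullet> K x)" for x
      using D[of x] unfolding gderiv_def by (rule frechet_derivative_at[symmetric])
    moreover have "Ck j (\<lambda>x. v \<bullet> K x)" for v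
      using assms(2) Ck_bounded_linear[OF bounded_linear_inner_right] unfolding smooth_def
      by fast
    ultimately show ?thesis
      using Suc diff by simp
  qed
qed

text \<open>
  Along the line through \<open>x\<close> and \<open>y\<close> this is the statement that a convex function of
  one real variable lies above its tangents.
\<close>

lemma convex_on_imp_above_tangent_plane:
  fixes f :: "'a::euclidean_space \<Rightarrow> real"
  assumes "convex_on UNIV f" and D: "GDERIV f x :> D"
  shows "f x + D \<bullet> (y - x) \<le> f y"
proof -
  define \<phi> where "\<phi> t = f (x + t *\<^sub>R (y - x))" for t
  have "convex_on UNIV \<phi>"
  proof (rule convex_onI)
    fix t a b :: real
    assume t: "0 < t" "t < 1"
    have "x + ((1 - t) *\<^sub>R a + t *\<^sub>R b) *\<^sub>R (y - x)
        = (1 - t) *\<^sub>R (x + a *\<^sub>R (y - x)) + t *\<^sub>R (x + b *\<^sub>R (y - x))"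
      by (simp add: algebra_simps)
    then show "\<phi> ((1 - t) *\<^sub>R a + t *\<^sub>R b) \<le> (1 - t) * \<phi> a + t * \<phi> b"
      unfolding \<phi>_def using convex_onD[OF assms(1), of t] t by simp
  qed simp
  moreover have "(\<phi> has_field_derivative D \<bullet> (y - x)) (at 0)"
  proof -
    have "((\<lambda>t. x + t *\<^sub>R (y - x)) has_derivative (\<lambda>t. t *\<^sub>R (y - x))) (at 0)"
      by (auto intro!: derivative_eq_intros)
    moreover have "(f has_derivative (\<lambda>h. h \<bullet> D)) (at (x + 0 *\<^sub>R (y - x)))"
      using D unfolding gderiv_def by simp
    ultimately have "(\<phi> has_derivative (\<lambda>t. (t *\<^sub>R (y - x)) \<bullet> D)) (at 0)"
      unfolding \<phi>_def by (rule has_derivative_compose)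
    moreover have "(\<lambda>t. (t *\<^sub>R (y - x)) \<bullet> D) = (*) (D \<bullet> (y - x))"
      by (simp add: fun_eq_iff inner_commute)
    ultimately show ?thesis
      unfolding has_field_derivative_def by simp
  qed
  ultimately have "D \<bullet> (y - x) * (1 - 0) \<le> \<phi> 1 - \<phi> 0"
    by (intro convex_on_imp_above_tangent[where A = UNIV]) auto
  then show ?thesis
    unfolding \<phi>_def by simp
qed

text \<open>
  The point \<open>x\<close> is a critical point of the concave function \<open>v \<mapsto> D \<bullet> v - f(v)\<close>, hence
  a global maximum.
\<close>

lemma legendre_fenchel_at_gradient:
  fixes f :: "'a::euclidean_space \<Rightarrow> real"
  assumes "convex_on UNIV f" "GDERIV f x :> D"
  shows "legendre_fenchel f D = ereal (D \<bullet> x - f x)"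
  unfolding legendre_fenchel_def
proof (rule antisym)
  show "(SUP v. ereal (D \<bullet> v - f v)) \<le> ereal (D \<bullet> x - f x)"
  proof (rule SUP_least)
    fix v
    show "ereal (D \<bullet> v - f v) \<le> ereal (D \<bullet> x - f x)"
      using convex_on_imp_above_tangent_plane[OF assms, of v] by (simp add: inner_diff_right)
  qed
qed (rule SUP_upper, simp)

lemma convex_on_legendre_fenchel:
  fixes f :: "'a::euclidean_space \<Rightarrow> real"
  assumes g: "\<And>q. legendre_fenchel f q = ereal (g q)"
  shows "convex_on UNIV g"
proof (rule convex_onI)
  fix t :: real and q r :: 'a
  assume t: "0 < t" "t < 1"
  have upper: "p \<bullet> v - f v \<le> g p" for p v
  proof -
    have "ereal (p \<bullet> v - f v) \<le> legendre_fenchel f p"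
      unfolding legendre_fenchel_def by (rule SUP_upper) simp
    then show ?thesis
      using g by simp
  qed
  let ?p = "(1 - t) *\<^sub>R q + t *\<^sub>R r"
  have "legendre_fenchel f ?p \<le> ereal ((1 - t) * g q + t * g r)"
    unfolding legendre_fenchel_def
  proof (rule SUP_least)
    fix v
    have "?p \<bullet> v - f v = (1 - t) * (q \<bullet> v - f v) + t * (r \<bullet> v - f v)"
      by (simp add: inner_add_left algebra_simps)
    also have "\<dots> \<le> (1 - t) * g q + t * g r"
      using t upper by (intro add_mono mult_left_mono) auto
    finally show "ereal (?p \<bullet> v - f v) \<le> ereal ((1 - t) * g q + t * g r)"
      by simp
  qed
  then show "g ?p \<le> (1 - t) * g q + t * g r"
    using g by simp
qed simp

text \<open>
  The variation of \<open>K\<close> enters through \<open>q \<bullet> K'(q)h - \<nabla>f(K(q)) \<bullet> K'(q)h\<close>, which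
  vanishes because \<open>K(q)\<close> is critical for \<open>v \<mapsto> q \<bullet> v - f(v)\<close>.
\<close>

lemma GDERIV_legendre_transform:
  fixes f :: "'a::euclidean_space \<Rightarrow> real"
  assumes "K differentiable (at q)" and f: "GDERIV f (K q) :> q"
  shows "GDERIV (\<lambda>q. q \<bullet> K q - f (K q)) q :> K q"
proof -
  obtain K' where K: "(K has_derivative K') (at q)"
    using assms(1) unfolding differentiable_def by blast
  have "((\<lambda>q. f (K q)) has_derivative (\<lambda>h. K' h \<bullet> q)) (at q)"
    using K f unfolding gderiv_def by (rule has_derivative_compose)
  then have "((\<lambda>q. q \<bullet> K q - f (K q)) has_derivative
      (\<lambda>h. (q \<bullet> K' h + h \<bullet> K q) - K' h \<bullet> q)) (at q)"
    using K by (intro has_derivative_diff has_derivative_inner has_derivative_ident)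
  then show ?thesis
    unfolding gderiv_def by (simp add: inner_commute)
qed

theorem lemma2p14:
  fixes f :: "real ^ 'n \<Rightarrow> real"
  assumes "simple f"
    and "convex_on UNIV f"
  shows "\<exists>g :: real ^ 'n \<Rightarrow> real.
    (\<forall>q. legendre_fenchel f q = ereal (g q)) \<and>
    T_map ` one_graph f = one_graph g \<and>
    simple g \<and> convex_on UNIV g"
proof -
  define K where "K = inv (gradient f)"
  define g where "g q = q \<bullet> K q - f (K q)" for q
  have bij: "bij (gradient f)" and smooth: "smooth f" "smooth (gradient f)" "smooth K"
    using assms(1) unfolding simple_def diffeomorphism_def K_def by auto
  have K_grad: "K (gradient f x) = x" for x
    unfolding K_def using bij by (simp add: bij_is_inj)
  have grad_K: "gradient f (K q) = q" for q
    unfolding K_def using bij by (simp add: bij_is_surj surj_f_inv_f)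
  have f_deriv: "GDERIV f (K q) :> q" for q
    using GDERIV_gradient[OF smooth_imp_differentiable[OF smooth(1)], of "K q"]
    by (simp add: grad_K)
  have LF: "legendre_fenchel f q = ereal (g q)" for q
    unfolding g_def using assms(2) f_deriv by (rule legendre_fenchel_at_gradient)
  have g_deriv: "GDERIV g q :> K q" for q
    unfolding g_def
    using smooth_imp_differentiable[OF smooth(3)] f_deriv by (rule GDERIV_legendre_transform)
  have grad_g: "gradient g = K"
    using gradient_eq[OF g_deriv] by (rule ext)
  have jet: "T_map (f x, x, gradient f x) =
      (g (gradient f x), gradient f x, gradient g (gradient f x))" for x
    unfolding T_map_def grad_g by (simp add: g_def K_grad inner_commute)
  have "T_map ` one_graph f = range (\<lambda>x. T_map (f x, x, gradient f x))"
    unfolding one_graph_def by auto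
  also have "\<dots> = (\<lambda>q. (g q, q, gradient g q)) ` range (gradient f)"
    unfolding jet by auto
  also have "\<dots> = one_graph g"
    using bij unfolding one_graph_def bij_def by auto
  finally have graphs: "T_map ` one_graph f = one_graph g" .
  have "diffeomorphism K"
    unfolding diffeomorphism_def using bij smooth
    by (simp add: K_def inv_inv_eq bij_imp_bij_inv)
  moreover have "smooth g"
    using g_deriv smooth(3) by (rule smooth_if_gradient_smooth)
  ultimately have "simple g"
    unfolding simple_def grad_g by simp
  moreover have "convex_on UNIV g"
    using LF by (rule convex_on_legendre_fenchel)
  ultimately show ?thesis
    using LF graphs by (intro exI[of _ g] conjI allI)
qed

end
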